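(* Let $p$ be a prime, let $\alpha \in \mathbb{N}$, let $F$ be a finite field of characteristic $p$ with $q = p^{\alpha}$ elements, let $r, N \in \mathbb{N}$, and let $f_1,\ldots,f_r \in F[x_1,\ldots,x_N]$. Let $V(f_1,\ldots,f_r) := \{\mathbf{a} \in F^N \mid f_1(\mathbf{a}) = \cdots = f_r(\mathbf{a}) = 0\}$. If $0 \in V(f_1,\ldots,f_r)$, then $$|V(f_1,\ldots,f_r)| \ge q^{\,N - \sum_{j=1}^r \deg_p(f_j)}.$$
   Context: $\mathbb{N}$ is the set of positive integers. For a prime $p$ and $n \in \mathbb{N}_0 = \mathbb{N}\cup\{0\}$, $s_p(n)$ denotes the digit sum of $n$ in base $p$. For a field $F$ of characteristic $p$, the $p$-weight degree of a monomial $c \prod_{i=1}^N x_i^{\alpha_i}$ with $c \in F\setminus\{0\}$ is $\deg_p(c \prod_{i=1}^N x_i^{\alpha_i}) := \sum_{i=1}^N s_p(\alpha_i)$. The $p$-weight degree $\deg_p(f)$ of a nonzero polynomial $f \in F[x_1,\ldots,x_N]$ is the maximum of the $p$-weight degrees of its monomials, and $\deg_p(0) := 0$. The exponent $N - \sum_j \deg_p(f_j)$ is an integer that may be negative; the power is then a rational number. *)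

theory Defs
  imports
    Complex_Main
    "HOL-Library.Cardinality"
    "HOL-Library.FuncSet"
    "HOL-Library.Poly_Mapping"
    "HOL-Computational_Algebra.Primes"
begin

text \<open>
  A monomial is a finitely supported exponent function \<open>nat \<Rightarrow>\<^sub>0 nat\<close>, a polynomial a finitely
  supported coefficient function on monomials; addition and multiplication are those of
  \<^theory>\<open>HOL-Library.Poly_Mapping\<close>. The ring \<open>F[x\<^sub>1, \<dots>, x\<^sub>N]\<close> consists of the polynomials whose
  monomials only involve the variables with indices in \<open>{1..N}\<close>.
\<close>

type_synonym 'a mpoly = "(nat \<Rightarrow>\<^sub>0 nat) \<Rightarrow>\<^sub>0 'a"

definition mpolys :: "nat \<Rightarrow> 'a::zero mpoly set" where
  "mpolys N = {f. \<forall>m \<in> Poly_Mapping.keys f. Poly_Mapping.keys m \<subseteq> {1..N}}"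

definition mpoly_eval :: "'a::comm_semiring_1 mpoly \<Rightarrow> (nat \<Rightarrow> 'a) \<Rightarrow> 'a" where
  "mpoly_eval f a = (\<Sum>m \<in> Poly_Mapping.keys f. Poly_Mapping.lookup f m *
      (\<Prod>i \<in> Poly_Mapping.keys m. a i ^ Poly_Mapping.lookup m i))"

text \<open>
  \<open>(n div p ^ i) mod p\<close> is the base-\<open>p\<close> digit of \<open>n\<close> at position \<open>i\<close>. For \<open>p \<ge> 2\<close> all digits at
  positions \<open>i > n\<close> vanish, because \<open>n < p ^ n\<close>.
\<close>

definition digit_sum :: "nat \<Rightarrow> nat \<Rightarrow> nat" where
  "digit_sum p n = (\<Sum>i\<le>n. (n div p ^ i) mod p)"

definition monom_weight_degree :: "nat \<Rightarrow> (nat \<Rightarrow>\<^sub>0 nat) \<Rightarrow> nat" where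
  "monom_weight_degree p m = (\<Sum>i \<in> Poly_Mapping.keys m. digit_sum p (Poly_Mapping.lookup m i))"

definition weight_degree :: "nat \<Rightarrow> 'a::zero mpoly \<Rightarrow> nat" where
  "weight_degree p f = (if f = 0 then 0 else Max (monom_weight_degree p ` Poly_Mapping.keys f))"

text \<open>
  A point of \<open>F\<^sup>N\<close> is an extensional function on \<open>{1..N}\<close> (value \<open>undefined\<close> outside), so that
  distinct points are distinct functions and cardinalities are the intended ones.
\<close>

definition zero_set :: "nat \<Rightarrow> nat \<Rightarrow> (nat \<Rightarrow> 'a::comm_semiring_1 mpoly) \<Rightarrow> (nat \<Rightarrow> 'a) set" where
  "zero_set N r f = {a \<in> {1..N} \<rightarrow>\<^sub>E UNIV. \<forall>j \<in> {1..r}. mpoly_eval (f j) a = 0}"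

end

theory Submission
  imports
    Defs
    "HOL-Library.Function_Algebras"
    "HOL-Computational_Algebra.Polynomial"
    "HOL-Number_Theory.Cong"
begin

text \<open>
  The functional degree of a map from an abelian group to a field of characteristic \<open>p\<close> is
  the least \<open>d\<close> such that all \<open>(d + 1)\<close>-fold differences vanish. It is subadditive under
  multiplication, additive maps have degree at most \<open>1\<close>, and the Frobenius map does not increase it;
  hence a polynomial has functional degree at most its \<open>p\<close>-weight degree, and
  \<open>\<Prod>\<^sub>j (1 - f\<^sub>j ^ (q - 1))\<close>, which is nonzero exactly on the common zeros of the \<open>f\<^sub>j\<close>, has
  degree at most \<open>\<alpha> (p - 1) \<Sum>\<^sub>j deg\<^sub>p f\<^sub>j\<close>. As in the bound on the minimum distance of Reed--Muller
  codes, a nonzero function of degree at most \<open>D\<close> on an elementary abelian group of order \<open>p\<^sup>n\<close> has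
  at least \<open>p powr (n - D / (p - 1))\<close> nonzeros: if it vanishes on exactly \<open>b\<close> cosets of a
  subgroup of index \<open>p\<close>, its restriction to each of the \<open>p - b\<close> other ones has degree at most
  \<open>D - b\<close>, and \<open>(p - b) ^ (p - 1) \<ge> p ^ (p - 1 - b)\<close>.
\<close>

section \<open>Functional degree\<close>

text \<open>
  The strict bound \<open>k\<close> covers the zero function (\<open>k = 0\<close>) without a degree \<open>- \<infinity>\<close>.
\<close>

primrec fdeg_less :: "'b::plus set \<Rightarrow> nat \<Rightarrow> ('b \<Rightarrow> 'a::comm_ring_1) \<Rightarrow> bool" where
  "fdeg_less G 0 g \<longleftrightarrow> (\<forall>x\<in>G. g x = 0)"
| "fdeg_less G (Suc k) g \<longleftrightarrow> (\<forall>h\<in>G. fdeg_less G k (\<lambda>x. g (x + h) - g x))"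

definition add_closed :: "'b::plus set \<Rightarrow> bool" where
  "add_closed G \<longleftrightarrow> (\<forall>x\<in>G. \<forall>y\<in>G. x + y \<in> G)"

lemma add_closedD: "add_closed G \<Longrightarrow> x \<in> G \<Longrightarrow> y \<in> G \<Longrightarrow> x + y \<in> G"
  by (simp add: add_closed_def)

lemma fdeg_less_cong:
  assumes "add_closed G" "\<And>x. x \<in> G \<Longrightarrow> g x = g' x"
  shows "fdeg_less G k g \<longleftrightarrow> fdeg_less G k g'"
  using assms(2)
proof (induction k arbitrary: g g')
  case (Suc k)
  have "fdeg_less G k (\<lambda>x. g (x + h) - g x) \<longleftrightarrow> fdeg_less G k (\<lambda>x. g' (x + h) - g' x)"
    if "h \<in> G" for h
    by (rule Suc.IH) (simp add: Suc.prems add_closedD[OF assms(1)] that)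
  then show ?case
    by simp
qed simp

lemma fdeg_less_zero: "fdeg_less G k (\<lambda>_. 0)"
  by (induction k) simp_all

lemma fdeg_less_const: "fdeg_less G (Suc 0) (\<lambda>_. c)"
  by simp

lemma fdeg_less_Suc:
  assumes "add_closed G"
  shows "fdeg_less G k g \<Longrightarrow> fdeg_less G (Suc k) g"
proof (induction k arbitrary: g)
  case 0
  then show ?case
    by (simp add: add_closedD[OF assms])
next
  case (Suc k)
  have "fdeg_less G (Suc k) (\<lambda>x. g (x + h) - g x)" if "h \<in> G" for h
    by (rule Suc.IH) (use Suc.prems that in simp)
  then show ?case
    by (subst fdeg_less.simps) blast
qed

lemma fdeg_less_mono:
  assumes "add_closed G" "fdeg_less G k g" "k \<le> l"
  shows "fdeg_less G l g"
  using assms(3)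
proof (induction l rule: nat_induct_at_least)
  case base
  show ?case by fact
next
  case (Suc l)
  then show ?case
    by (intro fdeg_less_Suc assms(1))
qed

lemma fdeg_less_add:
  "fdeg_less G k f \<Longrightarrow> fdeg_less G k g \<Longrightarrow> fdeg_less G k (\<lambda>x. f x + g x)"
proof (induction k arbitrary: f g)
  case (Suc k)
  show ?case
    unfolding fdeg_less.simps
  proof
    fix h assume "h \<in> G"
    then have "fdeg_less G k (\<lambda>x. (f (x + h) - f x) + (g (x + h) - g x))"
      using Suc by simp
    then show "fdeg_less G k (\<lambda>x. f (x + h) + g (x + h) - (f x + g x))"
      by (simp add: algebra_simps)
  qed
qed simp

lemma fdeg_less_sum:
  "(\<And>i. i \<in> I \<Longrightarrow> fdeg_less G k (f i)) \<Longrightarrow> fdeg_less G k (\<lambda>x. \<Sum>i\<in>I. f i x)"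
  by (induction I rule: infinite_finite_induct)
     (auto intro: fdeg_less_zero fdeg_less_add)

text \<open>With differences \<open>f'\<close> and \<open>g'\<close> in direction \<open>h\<close>,
  the difference of the product is \<open>f' * g + f * g' + f' * g'\<close>, and induction on
  \<open>a + b\<close> bounds each term. If \<open>a\<close> or \<open>b\<close> is 0, the product
  vanishes on \<open>G\<close>, so the truncated \<open>a + b - 1\<close> does no harm.\<close>

lemma fdeg_less_mult:
  assumes "add_closed G"
  shows "fdeg_less G a f \<Longrightarrow> fdeg_less G b g \<Longrightarrow> fdeg_less G (a + b - 1) (\<lambda>x. f x * g x)"
proof (induction "a + b" arbitrary: a b f g rule: less_induct)
  case less
  show ?case
  proof (cases "a = 0 \<or> b = 0")
    case True
    with less.prems have "\<And>x. x \<in> G \<Longrightarrow> f x * g x = 0"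
      by auto
    then show ?thesis
      using fdeg_less_cong[OF assms, of "\<lambda>x. f x * g x" "\<lambda>_. 0"] fdeg_less_zero by blast
  next
    case False
    then obtain a' b' where ab: "a = Suc a'" "b = Suc b'"
      by (meson not0_implies_Suc)
    have "fdeg_less G (a' + b') (\<lambda>x. f (x + h) * g (x + h) - f x * g x)" if "h \<in> G" for h
    proof -
      define f' g' where "f' = (\<lambda>x. f (x + h) - f x)" and "g' = (\<lambda>x. g (x + h) - g x)"
      have f': "fdeg_less G a' f'" and g': "fdeg_less G b' g'"
        using less.prems that by (auto simp: ab f'_def g'_def)
      have "fdeg_less G (a' + b') (\<lambda>x. f' x * g x)"
        using less.hyps[OF _ f' less.prems(2)] by (simp add: ab)
      moreover have "fdeg_less G (a' + b') (\<lambda>x. f x * g' x)"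
        using less.hyps[OF _ less.prems(1) g'] by (simp add: ab)
      moreover have "fdeg_less G (a' + b') (\<lambda>x. f' x * g' x)"
        using less.hyps[OF _ f' g'] by (auto simp: ab intro: fdeg_less_mono[OF assms])
      ultimately have "fdeg_less G (a' + b') (\<lambda>x. f' x * g x + f x * g' x + f' x * g' x)"
        by (intro fdeg_less_add)
      then show ?thesis
        by (simp add: f'_def g'_def algebra_simps)
    qed
    then show ?thesis
      by (simp add: ab)
  qed
qed

lemma fdeg_less_prod:
  assumes "add_closed G" "\<And>i. i \<in> I \<Longrightarrow> fdeg_less G (Suc (d i)) (f i)"
  shows "fdeg_less G (Suc (\<Sum>i\<in>I. d i)) (\<lambda>x. \<Prod>i\<in>I. f i x)"
  using assms(2)
proof (induction I rule: infinite_finite_induct)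
  case (insert i I)
  then have "fdeg_less G (Suc (d i) + Suc (\<Sum>i\<in>I. d i) - 1) (\<lambda>x. f i x * (\<Prod>i\<in>I. f i x))"
    by (intro fdeg_less_mult assms(1)) auto
  then show ?case
    using insert.hyps by simp
qed simp_all

lemma fdeg_less_power:
  assumes "add_closed G" "fdeg_less G (Suc d) f"
  shows "fdeg_less G (Suc (n * d)) (\<lambda>x. f x ^ n)"
  using fdeg_less_prod[of G "{..<n}" "\<lambda>_. d" "\<lambda>_. f"] assms by simp

lemma fdeg_less_additive:
  assumes "add_closed G" "\<And>x y. x \<in> G \<Longrightarrow> y \<in> G \<Longrightarrow> f (x + y) = f x + f y"
  shows "fdeg_less G (Suc (Suc 0)) f"
  using assms by (simp add: add_closedD)

text \<open>Along \<open>\<phi>\<close>, a shift by \<open>h\<close> becomes a shift by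
  \<open>\<psi> h\<close>, so differences of the pullback are pullbacks of differences. The use is
  restriction to a line parallel to \<open>e\<close>.\<close>

lemma fdeg_less_comp:
  assumes "\<And>x. x \<in> K \<Longrightarrow> \<phi> x \<in> G" "\<And>x. x \<in> K \<Longrightarrow> \<psi> x \<in> G"
    and "\<And>x y. \<phi> (x + y) = \<phi> x + \<psi> y"
  shows "fdeg_less G k g \<Longrightarrow> fdeg_less K k (\<lambda>x. g (\<phi> x))"
proof (induction k arbitrary: g)
  case (Suc k)
  have "fdeg_less K k (\<lambda>x. g (\<phi> x + \<psi> h) - g (\<phi> x))" if "h \<in> K" for h
    using Suc.IH[of "\<lambda>y. g (y + \<psi> h) - g y"] Suc.prems assms(2)[OF that] by simp
  then show ?case
    by (simp add: assms(3))
qed (simp add: assms(1))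

declare fdeg_less.simps(2) [simp del]

section \<open>Functions on the natural numbers\<close>

lemma newton_forward_difference:
  fixes u :: "nat \<Rightarrow> 'a::comm_ring_1"
  assumes "fdeg_less UNIV b u"
  obtains c where "\<And>t. u t = (\<Sum>k<b. c k * of_nat (t choose k))"
  using assms
proof (induction b arbitrary: u thesis)
  case (Suc b)
  from Suc.prems(2) have "fdeg_less UNIV b (\<lambda>t. u (t + 1) - u t)"
    unfolding fdeg_less.simps by blast
  from Suc.IH[OF _ this] obtain c
    where c: "\<And>t. u (t + 1) - u t = (\<Sum>k<b. c k * of_nat (t choose k))"
    by blast
  \<comment> \<open>Summing the first difference raises each binomial index by one, by Pascal's
    rule, and leaves \<open>u 0\<close> as the constant coefficient.\<close>
  define c' where "c' k = (case k of 0 \<Rightarrow> u 0 | Suc k \<Rightarrow> c k)" for k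
  have "u t = (\<Sum>k<Suc b. c' k * of_nat (t choose k))" for t
  proof (induction t)
    case 0
    then show ?case
      by (simp add: sum.lessThan_Suc_shift[of _ b] c'_def del: sum.lessThan_Suc)
  next
    case (Suc t)
    have "u (Suc t) = u t + (\<Sum>k<b. c k * of_nat (t choose k))"
      using c[of t] by (simp add: algebra_simps)
    then show ?case
      by (simp add: Suc.IH sum.lessThan_Suc_shift[of _ b] c'_def algebra_simps sum.distrib
        del: sum.lessThan_Suc)
  qed
  with Suc.prems(1) show ?case
    by blast
qed simp

lemma fact_mult_of_nat_binomial:
  "of_nat (fact k) * of_nat (t choose k) = (\<Prod>i<k. (of_nat t - of_nat i :: 'a::comm_ring_1))"
proof (induction k)
  case (Suc k)
  have "Suc k * (t choose Suc k) = (t - k) * (t choose k)"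
    using binomial_absorption[of k t] binomial_absorb_comp[of t k] by simp
  then have "of_nat (Suc k) * of_nat (t choose Suc k) = of_nat (t - k) * (of_nat (t choose k) :: 'a)"
    by (metis of_nat_mult)
  \<comment> \<open>For \<open>t < k\<close> the truncated difference is harmless, since
    \<open>t choose k\<close> is 0.\<close>
  also have "\<dots> = (of_nat t - of_nat k) * of_nat (t choose k)"
    by (cases "k \<le> t") (simp_all add: of_nat_diff binomial_eq_0)
  finally have "of_nat (fact k) * (of_nat (Suc k) * of_nat (t choose Suc k))
      = of_nat (fact k) * ((of_nat t - of_nat k) * (of_nat (t choose k) :: 'a))"
    by simp
  then show ?case
    by (simp only: fact_Suc Suc.IH[symmetric] of_nat_mult of_nat_id prod.lessThan_Suc mult_ac)
qed simp

lemma of_nat_inj_on_lessThan_CHAR: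
  "inj_on (of_nat :: nat \<Rightarrow> 'a::ring_1) {..<CHAR('a)}"
  by (auto simp: inj_on_def of_nat_eq_iff_cong_CHAR cong_def)

text \<open>Since \<open>b \<le> CHAR('a)\<close>, the factorials of all \<open>k < b\<close> are
  invertible, so for \<open>b > 0\<close> the Newton expansion is a polynomial in
  \<open>of_nat t\<close> of degree less than \<open>b\<close>. The elements of \<open>B\<close>
  give it \<open>b\<close> distinct roots.\<close>

lemma fdeg_less_imp_zero:
  fixes u :: "nat \<Rightarrow> 'a::field"
  assumes "fdeg_less UNIV b u" "prime CHAR('a)"
    and "B \<subseteq> {..<CHAR('a)}" "card B = b" "\<And>t. t \<in> B \<Longrightarrow> u t = 0"
  shows "u t = 0"
proof (cases "b = 0")
  case True
  then show ?thesis
    using assms(1) by simp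
next
  case False
  obtain c where c: "\<And>t. u t = (\<Sum>k<b. c k * of_nat (t choose k))"
    using newton_forward_difference[OF assms(1)] by blast
  define P where "P = (\<Sum>k<b. smult (c k / of_nat (fact k)) (\<Prod>i<k. [:- of_nat i, 1:]))"
  have "b \<le> CHAR('a)"
    using card_mono[OF _ assms(3)] assms(4) by simp
  then have fact: "of_nat (fact k) \<noteq> (0::'a)" if "k < b" for k
    using that prime_dvd_fact_iff[OF assms(2), of k] by (simp add: of_nat_eq_0_iff_char_dvd)
  have "c k * of_nat (t choose k) = c k / of_nat (fact k) * (\<Prod>i<k. of_nat t - of_nat i)"
    if "k < b" for k t
    using fact[OF that] by (simp flip: fact_mult_of_nat_binomial)
  then have uP: "u t = poly P (of_nat t)" for t
    by (simp add: c P_def poly_sum poly_prod)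
  have "degree P \<le> b - 1"
    unfolding P_def
  proof (intro degree_sum_le)
    fix k assume "k \<in> {..<b}"
    have "degree (\<Prod>i<k. [:- of_nat i, 1 :: 'a:]) \<le> sum (degree \<circ> (\<lambda>i. [:- of_nat i, 1 :: 'a:])) {..<k}"
      by (rule degree_prod_sum_le) simp
    then show "degree (smult (c k / of_nat (fact k)) (\<Prod>i<k. [:- of_nat i, 1:])) \<le> b - 1"
      using \<open>k \<in> {..<b}\<close> degree_smult_le[of "c k / of_nat (fact k)" "\<Prod>i<k. [:- of_nat i, 1:]"]
      by (simp add: o_def)
  qed simp
  moreover have "card (of_nat ` B :: 'a set) = b"
    using card_image[OF inj_on_subset[OF of_nat_inj_on_lessThan_CHAR assms(3)]] assms(4) by simp
  ultimately have "P = 0"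
    using False assms(5) by (intro poly_eqI_degree[of "of_nat ` B"]) (auto simp: uP)
  then show ?thesis
    by (simp add: uP)
qed

section \<open>Elementary abelian groups\<close>

text \<open>
  An elementary abelian \<open>p\<close>-group is modelled as a set containing \<open>0\<close> and closed under addition in
  a ring with \<open>of_nat p = 0\<close>; the ring only serves to write multiples as \<open>of_nat t * e\<close>.
\<close>

definition adjoin :: "'b::ring_1 set \<Rightarrow> 'b \<Rightarrow> 'b set" where
  "adjoin H e = (\<lambda>(h, t). h + of_nat t * e) ` (H \<times> (UNIV :: nat set))"

lemma adjoin_memI: "h \<in> H \<Longrightarrow> h + of_nat t * e \<in> adjoin H e"
  by (force simp: adjoin_def)

lemma subset_adjoin: "H \<subseteq> adjoin H e"
  using adjoin_memI[of _ H 0 e] by auto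

lemma mem_adjoin: "0 \<in> H \<Longrightarrow> e \<in> adjoin H e"
  using adjoin_memI[of 0 H 1 e] by auto

lemma of_nat_mult_mem:
  fixes x :: "'b::ring_1"
  assumes "add_closed H" "0 \<in> H" "x \<in> H"
  shows "of_nat t * x \<in> H"
  by (induction t) (auto simp: assms algebra_simps intro: add_closedD)

lemma uminus_mem:
  fixes x :: "'b::ring_1"
  assumes "add_closed H" "0 \<in> H" "x \<in> H" "of_nat p = (0::'b)" "p > 0"
  shows "- x \<in> H"
proof -
  have "of_nat (p - 1) * x = - x"
    using assms by (simp add: of_nat_diff)
  then show ?thesis
    using of_nat_mult_mem[OF assms(1-3)] by metis
qed

lemma add_closed_adjoin:
  assumes "add_closed H"
  shows "add_closed (adjoin H e)"
  unfolding add_closed_def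
proof (intro ballI)
  fix x y assume "x \<in> adjoin H e" "y \<in> adjoin H e"
  then obtain h t h' t' where "x = h + of_nat t * e" "h \<in> H" "y = h' + of_nat t' * e" "h' \<in> H"
    by (auto simp: adjoin_def)
  moreover from this have "x + y = (h + h') + of_nat (t + t') * e"
    by (simp add: algebra_simps)
  ultimately show "x + y \<in> adjoin H e"
    using assms adjoin_memI add_closedD by metis
qed

lemma adjoin_subset:
  assumes "add_closed G" "0 \<in> G" "H \<subseteq> G" "e \<in> G"
  shows "adjoin H e \<subseteq> G"
  using assms by (auto simp: adjoin_def intro!: add_closedD of_nat_mult_mem)

text \<open>Two representations with \<open>t < t'\<close> would put
  \<open>of_nat (t' - t) * e\<close> into \<open>H\<close>; as \<open>t' - t\<close> is invertible
  modulo \<open>p\<close>, this forces \<open>e \<in> H\<close>. Thus \<open>adjoin H e\<close>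
  splits into \<open>p\<close> cosets of \<open>H\<close>.\<close>

lemma bij_betw_adjoin:
  fixes e :: "'b::ring_1"
  assumes "add_closed H" "0 \<in> H" "prime p" "of_nat p = (0::'b)" "e \<notin> H"
  shows "bij_betw (\<lambda>(h, t). h + of_nat t * e) (H \<times> {..<p}) (adjoin H e)"
proof -
  have p: "p > 0"
    using assms(3) by (simp add: prime_gt_0_nat)
  have le: "t' \<le> t" if "h \<in> H" "h' \<in> H" "t < p" "t' < p" "h + of_nat t * e = h' + of_nat t' * e"
    for h h' t t'
  proof (rule ccontr)
    assume "\<not> t' \<le> t"
    then have "\<not> p dvd t' - t"
      using that by (auto dest: dvd_imp_le)
    then have "coprime (t' - t) p"
      using assms(3) by (simp add: prime_imp_coprime coprime_commute)
    then obtain s where "[(t' - t) * s = 1] (mod p)"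
      using cong_solve_coprime_nat[of "t' - t" p] by auto
    moreover have "CHAR('b) dvd p"
      using assms(4) by (simp add: of_nat_eq_0_iff_char_dvd)
    ultimately have s: "of_nat ((t' - t) * s) = (1::'b)"
      using cong_dvd_modulus_nat of_nat_eq_iff_cong_CHAR by (metis of_nat_1)
    have "of_nat (t' - t) * e = h + - h'"
      using that \<open>\<not> t' \<le> t\<close> by (simp add: of_nat_diff algebra_simps)
    also have "\<dots> \<in> H"
      using that uminus_mem[OF assms(1,2) _ assms(4) p] add_closedD[OF assms(1)] by blast
    finally have "of_nat s * (of_nat (t' - t) * e) \<in> H"
      by (rule of_nat_mult_mem[OF assms(1,2)])
    also have "of_nat s * (of_nat (t' - t) * e) = of_nat ((t' - t) * s) * e"
      by (simp add: mult.assoc[symmetric] flip: of_nat_mult) (simp add: mult.commute)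
    finally show False
      using s assms(5) by simp
  qed
  show ?thesis
  proof (rule bij_betwI')
    fix x y assume "x \<in> H \<times> {..<p}" "y \<in> H \<times> {..<p}"
    then show "((\<lambda>(h, t). h + of_nat t * e) x = (\<lambda>(h, t). h + of_nat t * e) y) = (x = y)"
      using le[of "fst x" "fst y" "snd x" "snd y"] le[of "fst y" "fst x" "snd y" "snd x"]
      by (auto simp: split_beta prod_eq_iff)
  next
    fix x assume "x \<in> H \<times> {..<p}"
    then show "(\<lambda>(h, t). h + of_nat t * e) x \<in> adjoin H e"
      by (auto intro: adjoin_memI)
  next
    fix y assume "y \<in> adjoin H e"
    then obtain h t where "h \<in> H" "y = h + of_nat t * e"
      by (auto simp: adjoin_def)
    moreover have "of_nat t = (of_nat (t mod p) :: 'b)"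
      by (metis assms(4) add.right_neutral mult_zero_left mult_zero_right of_nat_add of_nat_mult
          add.commute div_mult_mod_eq)
    ultimately show "\<exists>x\<in>H \<times> {..<p}. y = (\<lambda>(h, t). h + of_nat t * e) x"
      using p by (intro bexI[of _ "(h, t mod p)"]) auto
  qed
qed

text \<open>A maximal closed subset of \<open>G\<close> that contains 0 and satisfies
  \<open>P\<close> is \<open>G\<close> itself: adjoining a missing element would enlarge it.\<close>

lemma elementary_abelian_induct [consumes 3, case_names zero adjoin]:
  fixes G :: "'b::ring_1 set"
  assumes "finite G" "add_closed G" "0 \<in> G"
    and zero: "P {0}"
    and adjoin: "\<And>H e. add_closed H \<Longrightarrow> 0 \<in> H \<Longrightarrow> finite (adjoin H e)
      \<Longrightarrow> e \<notin> H \<Longrightarrow> P H \<Longrightarrow> P (adjoin H e)"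
  shows "P G"
proof -
  define S where "S = {H. H \<subseteq> G \<and> add_closed H \<and> 0 \<in> H \<and> P H}"
  have "finite S" "{0} \<in> S"
    using assms by (auto simp: S_def add_closed_def intro: finite_subset[of _ "Pow G"])
  then obtain H where H: "H \<in> S" and max: "\<And>K. K \<in> S \<Longrightarrow> H \<subseteq> K \<Longrightarrow> H = K"
    using finite_has_maximal[of S] by blast
  have "H = G"
  proof (rule ccontr)
    assume "H \<noteq> G"
    then obtain e where e: "e \<in> G" "e \<notin> H"
      using H by (auto simp: S_def)
    then have sub: "adjoin H e \<subseteq> G"
      using H assms by (intro adjoin_subset) (auto simp: S_def)
    then have "adjoin H e \<in> S"
      using H e adjoin[of H e] finite_subset[OF sub assms(1)] add_closed_adjoin subset_adjoin[of H e]
      by (auto simp: S_def)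
    from max[OF this subset_adjoin] e(2) mem_adjoin[of H e] H show False
      by (auto simp: S_def)
  qed
  then show ?thesis
    using H by (simp add: S_def)
qed

text \<open>
  Vanishing on \<open>card B\<close> cosets of \<open>H\<close> lowers the degree on every coset by \<open>card B\<close>: after
  \<open>k\<close> differences in the directions of \<open>H\<close>, the function has degree less than \<open>card B\<close> on each line
  parallel to \<open>e\<close>, and vanishes at \<open>card B\<close> points of this line.
\<close>

lemma fdeg_less_coset:
  fixes g :: "'b::ring_1 \<Rightarrow> 'a::field"
  assumes "add_closed H" "0 \<in> H" "prime CHAR('a)" "B \<subseteq> {..<CHAR('a)}"
  shows "fdeg_less (adjoin H e) (card B + k) g
    \<Longrightarrow> (\<And>t h. t \<in> B \<Longrightarrow> h \<in> H \<Longrightarrow> g (h + of_nat t * e) = 0)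
    \<Longrightarrow> fdeg_less H k (\<lambda>h. g (h + of_nat t * e))"
proof (induction k arbitrary: g)
  case 0
  have "g (h + of_nat t * e) = 0" if h: "h \<in> H" for h
  proof (rule fdeg_less_imp_zero[OF _ assms(3,4) refl])
    show "fdeg_less UNIV (card B) (\<lambda>t. g (h + of_nat t * e))"
    proof (rule fdeg_less_comp[where \<phi> = "\<lambda>t. h + of_nat t * e" and \<psi> = "\<lambda>t. of_nat t * e"])
      show "fdeg_less (adjoin H e) (card B) g"
        using 0 by simp
      show "of_nat t * e \<in> adjoin H e" for t
        using adjoin_memI[OF assms(2), of t e] by simp
    qed (auto simp: algebra_simps intro!: adjoin_memI h)
  qed (use 0 h in auto)
  then show ?case
    by simp
next
  case (Suc k)
  show ?case
    unfolding fdeg_less.simps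
  proof
    fix h' assume h': "h' \<in> H"
    define g' where "g' = (\<lambda>x. g (x + h') - g x)"
    have swap: "h + of_nat t * e + h' = h + h' + of_nat t * e" for h t
      by (simp add: algebra_simps)
    have "fdeg_less H k (\<lambda>h. g' (h + of_nat t * e))"
    proof (rule Suc.IH)
      show "fdeg_less (adjoin H e) (card B + k) g'"
        using Suc.prems(1) h' subset_adjoin[of H e] by (auto simp: g'_def fdeg_less.simps(2))
      show "g' (h + of_nat t * e) = 0" if "t \<in> B" "h \<in> H" for t h
        using Suc.prems(2) that h' add_closedD[OF assms(1)] by (simp add: g'_def swap)
    qed
    then show "fdeg_less H k (\<lambda>h. g (h + h' + of_nat t * e) - g (h + of_nat t * e))"
      by (simp add: g'_def swap)
  qed
qed

text \<open>Induction on \<open>n\<close> with \<open>j\<close> fixed reduces this to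
  \<open>(n + 2) ^ j \<le> (n + 1) ^ j * (j + 1)\<close>.\<close>

lemma power_Suc_exchange_le:
  fixes j n :: nat
  assumes "j \<le> n"
  shows "Suc n ^ j \<le> Suc j ^ n"
  using assms
proof (induction n rule: nat_induct_at_least)
  case (Suc n)
  have *: "(n + 2) ^ i \<le> (n + 1) ^ i * (i + 1)" if "i \<le> n" for i
    using that
  proof (induction i)
    case (Suc i)
    \<comment> \<open>The factor \<open>i + 1\<close> is carried along and cancelled at the end. The
      comparison that remains, \<open>(n + 2) * (i + 1) \<le> (n + 1) * (i + 2)\<close>, amounts to
      \<open>i \<le> n\<close>.\<close>
    have "(n + 2) ^ Suc i * (i + 1) = (n + 2) ^ i * ((n + 2) * (i + 1))"
      by (simp only: power_Suc mult_ac)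
    also have "\<dots> \<le> (n + 1) ^ i * (i + 1) * ((n + 2) * (i + 1))"
      using Suc by (intro mult_le_mono1) simp
    also have "\<dots> \<le> (n + 1) ^ i * (i + 1) * ((n + 1) * (i + 2))"
      using Suc.prems by (intro mult_le_mono2) (simp add: algebra_simps)
    also have "\<dots> = ((n + 1) ^ Suc i * (Suc i + 1)) * (i + 1)"
      by (simp only: power_Suc mult_ac) simp
    finally have "(n + 2) ^ Suc i * (i + 1) \<le> ((n + 1) ^ Suc i * (Suc i + 1)) * (i + 1)" .
    then show ?case
      by (subst (asm) mult_le_cancel2) simp
  qed simp
  have "(n + 2) ^ j \<le> (n + 1) ^ j * (j + 1)"
    using * Suc by simp
  also have "\<dots> \<le> Suc j ^ n * (j + 1)"
    using Suc.IH by (intro mult_le_mono1) simp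
  finally show ?case
    by (simp add: mult_ac)
qed simp

text \<open>The bound \<open>card G * p powr (- D / (p - 1))\<close> on the number of nonzeros,
  raised to the power \<open>p - 1\<close> and cleared of denominators so as to stay in the natural
  numbers.\<close>

theorem card_support_ge:
  fixes g :: "'b::ring_1 \<Rightarrow> 'a::field"
  assumes "finite G" "add_closed G" "0 \<in> G" "of_nat p = (0::'b)" "prime p" "p = CHAR('a)"
    and "fdeg_less G (Suc D) g" "\<exists>x\<in>G. g x \<noteq> 0"
  shows "card G ^ (p - 1) \<le> card {x\<in>G. g x \<noteq> 0} ^ (p - 1) * p ^ D"
  using assms(1-3,7,8)
proof (induction G arbitrary: g D rule: elementary_abelian_induct)
  case zero
  then have "{x \<in> {0}. g x \<noteq> 0} = {0}"
    by auto
  then show ?case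
    using prime_gt_0_nat[OF assms(5)] by simp
next
  case (adjoin H e)
  have p: "p > 0"
    using assms(5) by (simp add: prime_gt_0_nat)
  have finH: "finite H"
    using adjoin.hyps(3) subset_adjoin finite_subset by blast
  note bij = bij_betw_adjoin[OF adjoin.hyps(1,2) assms(5,4) adjoin.hyps(4)]
  define S where "S t = {h\<in>H. g (h + of_nat t * e) \<noteq> 0}" for t
  define B where "B = {t\<in>{..<p}. S t = {}}"
  define b where "b = card B"
  have B: "B \<subseteq> {..<CHAR('a)}" "finite B"
    by (auto simp: B_def assms(6))
  have vanish: "g (h + of_nat t * e) = 0" if "t \<in> B" "h \<in> H" for t h
    using that unfolding B_def S_def by blast
  have coset: "fdeg_less H k (\<lambda>h. g (h + of_nat t * e))"
    if "fdeg_less (adjoin H e) (b + k) g" for k t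
    using fdeg_less_coset[OF adjoin.hyps(1,2) assms(5)[unfolded assms(6)] B(1), where g = g] that vanish
    unfolding b_def by blast
  \<comment> \<open>Otherwise the vanishing cosets exhaust the degree: \<open>coset\<close> with
    \<open>k = 0\<close> makes \<open>g\<close> vanish everywhere.\<close>
  have "b \<le> D"
  proof (rule ccontr)
    assume "\<not> b \<le> D"
    then have "fdeg_less (adjoin H e) (b + 0) g"
      by (intro fdeg_less_mono[OF add_closed_adjoin[OF adjoin.hyps(1)] adjoin.prems(1)]) simp
    from coset[OF this] show False
      using adjoin.prems(2) by (auto simp: adjoin_def)
  qed
  \<comment> \<open>The induction hypothesis is applied to one coset with the fewest nonzeros among
    those outside \<open>B\<close>; each of the others has at least \<open>m\<close>.\<close>
  define m where "m = Min ((card \<circ> S) ` ({..<p} - B))"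
  obtain x where "x \<in> adjoin H e" "g x \<noteq> 0"
    using adjoin.prems(2) by blast
  then obtain h0 t0 where "h0 \<in> H" "t0 < p" "g (h0 + of_nat t0 * e) \<noteq> 0"
    using bij_betw_imp_surj_on[OF bij] by force
  then have ne: "{..<p} - B \<noteq> {}"
    by (auto simp: B_def S_def)
  have m_le: "m \<le> card (S t)" if "t \<in> {..<p} - B" for t
    unfolding m_def by (rule Min_le) (use that in auto)
  have "m \<in> (card \<circ> S) ` ({..<p} - B)"
    unfolding m_def using ne by (intro Min_in) auto
  then obtain t where t: "t \<in> {..<p} - B" "m = card (S t)"
    by auto
  have Hm: "card H ^ (p - 1) \<le> m ^ (p - 1) * p ^ (D - b)"
    unfolding t(2) S_def
  proof (rule adjoin.IH)
    show "fdeg_less H (Suc (D - b)) (\<lambda>h. g (h + of_nat t * e))"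
      using adjoin.prems(1) \<open>b \<le> D\<close> by (intro coset) simp
    show "\<exists>x\<in>H. g (x + of_nat t * e) \<noteq> 0"
      using t(1) by (auto simp: B_def S_def)
  qed
  have card_G: "card (adjoin H e) = card H * p"
    using bij_betw_same_card[OF bij] by (simp add: card_cartesian_product)
  have "{x\<in>adjoin H e. g x \<noteq> 0} = (\<lambda>(h, t). h + of_nat t * e) ` (\<lambda>(t, h). (h, t)) ` (SIGMA t:{..<p}. S t)"
    unfolding bij_betw_imp_surj_on[OF bij, symmetric] by (force simp: S_def)
  also have "card \<dots> = card (SIGMA t:{..<p}. S t)"
  proof (subst card_image)
    show "inj_on (\<lambda>(h, t). h + of_nat t * e) ((\<lambda>(t, h). (h, t)) ` (SIGMA t:{..<p}. S t))"
      by (rule inj_on_subset[OF bij_betw_imp_inj_on[OF bij]]) (auto simp: S_def)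
  qed (auto intro!: card_image simp: inj_on_def)
  also have "\<dots> = (\<Sum>t<p. card (S t))"
    by (subst card_SigmaI) (auto simp: S_def finH)
  also have "\<dots> = (\<Sum>t\<in>{..<p} - B. card (S t))"
    by (rule sum.mono_neutral_right) (auto simp: B_def)
  also have "\<dots> \<ge> (\<Sum>t\<in>{..<p} - B. m)"
    by (intro sum_mono m_le)
  finally have supp: "(p - b) * m \<le> card {x\<in>adjoin H e. g x \<noteq> 0}"
    using B by (simp add: card_Diff_subset b_def assms(6))
  have "b < p"
    using psubset_card_mono[of "{..<p}" B] ne by (auto simp: b_def B_def)
  \<comment> \<open>The factor \<open>p ^ b\<close>, gained from the drop of the degree from
    \<open>D\<close> to \<open>D - b\<close>, pays for the loss of \<open>b\<close> of the
    \<open>p\<close> cosets.\<close>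
  then have pb: "p ^ (p - 1) \<le> (p - b) ^ (p - 1) * p ^ b"
    using power_Suc_exchange_le[of "p - 1 - b" "p - 1"] p
      mult_le_mono1[of "p ^ (p - 1 - b)" "(p - b) ^ (p - 1)" "p ^ b"]
    by (simp add: Suc_diff_Suc flip: power_add)
  have "card (adjoin H e) ^ (p - 1) = card H ^ (p - 1) * p ^ (p - 1)"
    by (simp add: card_G power_mult_distrib)
  also have "\<dots> \<le> (m ^ (p - 1) * p ^ (D - b)) * ((p - b) ^ (p - 1) * p ^ b)"
    using Hm pb by (rule mult_le_mono)
  also have "\<dots> = ((p - b) * m) ^ (p - 1) * p ^ D"
    using \<open>b \<le> D\<close> by (simp add: power_mult_distrib mult_ac flip: power_add)
  also have "\<dots> \<le> card {x\<in>adjoin H e. g x \<noteq> 0} ^ (p - 1) * p ^ D"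
    using supp by (intro mult_le_mono1 power_mono) auto
  finally show ?case .
qed

section \<open>Functional degree and weight degree\<close>

text \<open>Raising to the power \<open>p ^ i\<close> is additive in characteristic
  \<open>p\<close>, hence commutes with differences.\<close>

lemma fdeg_less_frobenius:
  fixes f :: "'b::plus \<Rightarrow> 'a::field"
  assumes "prime p" "p = CHAR('a)"
  shows "fdeg_less G k f \<Longrightarrow> fdeg_less G k (\<lambda>x. f x ^ p ^ i)"
proof (induction k arbitrary: f)
  case 0
  then show ?case
    using prime_gt_0_nat[OF assms(1)] by simp
next
  case (Suc k)
  have diff: "(x - y) ^ p ^ i = x ^ p ^ i - y ^ p ^ i" for x y :: 'a
    using freshmans_dream'[of "p ^ i" i "x - y" y] assms by (simp add: algebra_simps)
  have "fdeg_less G k (\<lambda>x. f (x + h) ^ p ^ i - f x ^ p ^ i)" if "h \<in> G" for h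
    unfolding diff[symmetric]
    by (rule Suc.IH) (use Suc.prems that in \<open>simp add: fdeg_less.simps(2)\<close>)
  then show ?case
    by (simp add: fdeg_less.simps(2))
qed

text \<open>The powers \<open>p ^ i\<close> cost no degree, so only the sum of the coefficients
  enters. It is applied to the digits of an exponent and to those of \<open>q - 1\<close>.\<close>

lemma fdeg_less_power_base:
  fixes f :: "'b::plus \<Rightarrow> 'a::field"
  assumes "add_closed G" "prime p" "p = CHAR('a)" "fdeg_less G (Suc d) f"
  shows "fdeg_less G (Suc ((\<Sum>i\<in>I. c i) * d)) (\<lambda>x. f x ^ (\<Sum>i\<in>I. c i * p ^ i))"
proof -
  have "fdeg_less G (Suc (\<Sum>i\<in>I. c i * d)) (\<lambda>x. \<Prod>i\<in>I. (f x ^ p ^ i) ^ c i)"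
    using assms by (intro fdeg_less_prod fdeg_less_power fdeg_less_frobenius)
  then show ?thesis
    by (simp add: power_sum sum_distrib_right mult.commute[of "c _" "p ^ _"] power_mult)
qed

lemma sum_digits_mod: "(\<Sum>i<n. k div p ^ i mod p * p ^ i) = k mod p ^ n" for k p :: nat
  by (induction n) (simp_all add: mod_mult2_eq mult.commute[of p] power_Suc)

lemma sum_digits:
  assumes "p \<ge> 2"
  shows "(\<Sum>i\<le>n. n div p ^ i mod p * p ^ i) = n"
proof -
  have "n < p ^ Suc n"
    using less_exp[of "Suc n"] power_mono[OF assms, of "Suc n"] by linarith
  then show ?thesis
    using sum_digits_mod[where n = "Suc n" and k = n]
    by (simp add: lessThan_Suc_atMost del: power_Suc sum.lessThan_Suc)
qed

lemma fdeg_less_monom: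
  fixes G :: "(nat \<Rightarrow> 'a::field) set"
  assumes "add_closed G" "prime p" "p = CHAR('a)"
  shows "fdeg_less G (Suc (monom_weight_degree p m))
    (\<lambda>a. \<Prod>i\<in>Poly_Mapping.keys m. a i ^ Poly_Mapping.lookup m i)"
  unfolding monom_weight_degree_def
proof (intro fdeg_less_prod assms(1))
  fix i
  let ?n = "Poly_Mapping.lookup m i"
  have "fdeg_less G (Suc (Suc 0)) (\<lambda>a. a i)"
    by (rule fdeg_less_additive[OF assms(1)]) simp
  from fdeg_less_power_base[OF assms this, where I = "{..?n}" and c = "\<lambda>j. ?n div p ^ j mod p"]
  show "fdeg_less G (Suc (digit_sum p ?n)) (\<lambda>a. a i ^ ?n)"
    using prime_ge_2_nat[OF assms(2)] by (simp add: sum_digits digit_sum_def)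
qed

lemma fdeg_less_mpoly_eval:
  fixes G :: "(nat \<Rightarrow> 'a::field) set"
  assumes "add_closed G" "prime p" "p = CHAR('a)"
  shows "fdeg_less G (Suc (weight_degree p f)) (mpoly_eval f)"
  unfolding mpoly_eval_def[abs_def]
proof (rule fdeg_less_sum)
  fix m assume m: "m \<in> Poly_Mapping.keys f"
  have "fdeg_less G (Suc 0 + Suc (monom_weight_degree p m) - 1) (\<lambda>a. Poly_Mapping.lookup f m *
      (\<Prod>i\<in>Poly_Mapping.keys m. a i ^ Poly_Mapping.lookup m i))"
    by (intro fdeg_less_mult fdeg_less_const fdeg_less_monom assms)
  moreover have "monom_weight_degree p m \<le> weight_degree p f"
    using m by (auto simp: weight_degree_def)
  ultimately show "fdeg_less G (Suc (weight_degree p f)) (\<lambda>a. Poly_Mapping.lookup f m *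
      (\<Prod>i\<in>Poly_Mapping.keys m. a i ^ Poly_Mapping.lookup m i))"
    by (elim fdeg_less_mono[OF assms(1)]) simp
qed

section \<open>Zero sets\<close>

text \<open>Multiplication by \<open>x\<close> permutes the nonzero elements, so their product,
  itself nonzero, is unchanged.\<close>

lemma power_card_minus_1:
  fixes x :: "'a::{field,finite}"
  assumes "x \<noteq> 0"
  shows "x ^ (CARD('a) - 1) = 1"
proof -
  have "\<Prod>(UNIV - {0}) = (\<Prod>y\<in>UNIV - {0}. x * y)"
    by (rule prod.reindex_bij_witness[of _ "\<lambda>y. x * y" "\<lambda>y. y / x"]) (use assms in auto)
  also have "\<dots> = x ^ (CARD('a) - 1) * \<Prod>(UNIV - {0})"
    by (simp add: prod.distrib card_Diff_singleton)
  finally show ?thesis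
    by simp
qed

text \<open>For \<open>q = p ^ n\<close> this is the base-\<open>p\<close> expansion of
  \<open>q - 1\<close>: its \<open>n\<close> digits are all \<open>p - 1\<close>.\<close>

lemma sum_top_digits: "p > 0 \<Longrightarrow> (\<Sum>i<n. (p - 1) * p ^ i) = p ^ n - 1" for p :: nat
  by (induction n) (simp_all add: algebra_simps)

text \<open>Allows passing between the points of \<open>zero_set\<close>, \<open>undefined\<close>
  outside \<open>{1..N}\<close>, and functions that are 0 there.\<close>

lemma mpoly_eval_restrict:
  assumes "f \<in> mpolys N"
  shows "mpoly_eval f (restrict a {1..N}) = mpoly_eval f a"
proof -
  have "restrict a {1..N} i = a i" if "m \<in> Poly_Mapping.keys f" "i \<in> Poly_Mapping.keys m" for m i
  proof -
    have "i \<in> {1..N}"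
      using assms that unfolding mpolys_def by blast
    then show ?thesis
      by simp
  qed
  then show ?thesis
    unfolding mpoly_eval_def by (auto intro!: sum.cong prod.cong)
qed

theorem theorem14p1:
  fixes p \<alpha> q r N :: nat
    and f :: "nat \<Rightarrow> 'a::{field,finite} mpoly"
  assumes "prime p" and "\<alpha> \<ge> 1"
    and "CHAR('a) = p" and "q = p ^ \<alpha>" and "CARD('a) = q"
    and "r \<ge> 1" and "N \<ge> 1"
    and "\<And>j. j \<in> {1..r} \<Longrightarrow> f j \<in> mpolys N"
    and "(\<lambda>i\<in>{1..N}. 0) \<in> zero_set N r f"
  shows "real (card (zero_set N r f))
           \<ge> real q powi (int N - (\<Sum>j=1..r. int (weight_degree p (f j))))"
proof -
  have p: "p > 1"
    using assms(1) by (rule prime_gt_1_nat)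
  then have p0: "p > 0"
    by simp
  have q: "q > 1"
    using one_less_power[OF p, of \<alpha>] assms(2,4) by simp
  define w where "w = (\<Sum>j=1..r. weight_degree p (f j))"
  \<comment> \<open>Extension by 0 in place of \<open>undefined\<close> gives a copy of the point
    space that is closed under pointwise addition.\<close>
  define G :: "(nat \<Rightarrow> 'a) set" where "G = {a. \<forall>i. i \<notin> {1..N} \<longrightarrow> a i = 0}"
  define g where "g a = (\<Prod>j=1..r. 1 - mpoly_eval (f j) a ^ (q - 1))" for a
  have G: "add_closed G" "0 \<in> G"
    by (auto simp: add_closed_def G_def)
  have bij: "bij_betw (\<lambda>a. restrict a {1..N}) G ({1..N} \<rightarrow>\<^sub>E UNIV)"
    by (rule bij_betw_byWitness[where f' = "\<lambda>a i. if i \<in> {1..N} then a i else 0"])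
       (auto simp: G_def fun_eq_iff PiE_def extensional_def)
  have finG: "finite G"
    using bij_betw_finite[OF bij] by (simp add: finite_PiE)
  have cardG: "card G = q ^ N"
    using bij_betw_same_card[OF bij] assms(5) by (simp add: card_PiE)
  have g_eq_0: "g a \<noteq> 0 \<longleftrightarrow> (\<forall>j\<in>{1..r}. mpoly_eval (f j) a = 0)" for a
  proof -
    \<comment> \<open>For \<open>x = 0\<close> the power is 0 because \<open>q - 1 > 0\<close>; for
      all other \<open>x\<close> it is 1.\<close>
    have "1 - x ^ (q - 1) = 0 \<longleftrightarrow> x \<noteq> 0" for x :: 'a
      using power_card_minus_1[of x] q assms(5)
      by (cases "x = 0") (auto simp: zero_power)
    then show ?thesis
      by (simp add: g_def)
  qed
  have zero: "restrict a {1..N} \<in> zero_set N r f \<longleftrightarrow> g a \<noteq> 0" for a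
    using mpoly_eval_restrict[OF assms(8)] unfolding zero_set_def g_eq_0 by auto
  have "(\<lambda>a. restrict a {1..N}) ` {a\<in>G. g a \<noteq> 0} = zero_set N r f"
  proof (intro equalityI subsetI)
    fix x assume x: "x \<in> zero_set N r f"
    then have "x \<in> (\<lambda>a. restrict a {1..N}) ` G"
      unfolding bij_betw_imp_surj_on[OF bij] by (simp add: zero_set_def)
    with x zero show "x \<in> (\<lambda>a. restrict a {1..N}) ` {a\<in>G. g a \<noteq> 0}"
      by blast
  qed (use zero in blast)
  then have "bij_betw (\<lambda>a. restrict a {1..N}) {a\<in>G. g a \<noteq> 0} (zero_set N r f)"
    by (intro bij_betw_subset[OF bij]) auto
  then have supp: "card {a\<in>G. g a \<noteq> 0} = card (zero_set N r f)"
    by (rule bij_betw_same_card)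
  have "fdeg_less G (Suc (\<Sum>j=1..r. \<alpha> * (p - 1) * weight_degree p (f j))) g"
    unfolding g_def[abs_def]
  proof (rule fdeg_less_prod[OF G(1)])
    fix j
    have "fdeg_less G (Suc (\<alpha> * (p - 1) * weight_degree p (f j)))
        (\<lambda>a. mpoly_eval (f j) a ^ (q - 1))"
      using fdeg_less_power_base[OF G(1) assms(1) assms(3)[symmetric]
          fdeg_less_mpoly_eval[OF G(1) assms(1) assms(3)[symmetric], of "f j"],
          where I = "{..<\<alpha>}" and c = "\<lambda>_. p - 1"]
      unfolding sum_top_digits[OF p0] assms(4) by simp
    then have "fdeg_less G (Suc (\<alpha> * (p - 1) * weight_degree p (f j)))
        (\<lambda>a. 1 + (- 1) * mpoly_eval (f j) a ^ (q - 1))"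
      using fdeg_less_mult[OF G(1) fdeg_less_const[of G "- 1"]]
      by (intro fdeg_less_add fdeg_less_mono[OF G(1) fdeg_less_const]) auto
    then show "fdeg_less G (Suc (\<alpha> * (p - 1) * weight_degree p (f j)))
        (\<lambda>a. 1 - mpoly_eval (f j) a ^ (q - 1))"
      by simp
  qed
  then have "fdeg_less G (Suc (\<alpha> * (p - 1) * w)) g"
    by (simp add: w_def sum_distrib_left)
  moreover have "\<exists>x\<in>G. g x \<noteq> 0"
  proof
    have "restrict 0 {1..N} = (\<lambda>i\<in>{1..N}. 0 :: 'a)"
      by auto
    then have "mpoly_eval (f j) 0 = 0" if "j \<in> {1..r}" for j
      using assms(9) mpoly_eval_restrict[OF assms(8)[OF that], of 0] that by (simp add: zero_set_def)
    then show "g 0 \<noteq> 0"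
      by (simp add: g_eq_0)
  qed (rule G(2))
  moreover have "of_nat p = (0 :: nat \<Rightarrow> 'a)"
    using of_nat_CHAR[where 'a = 'a] assms(3) by (simp add: of_nat_fun zero_fun_def)
  ultimately have "card G ^ (p - 1) \<le> card {a\<in>G. g a \<noteq> 0} ^ (p - 1) * p ^ (\<alpha> * (p - 1) * w)"
    using finG G assms(1,3) by (intro card_support_ge) auto
  \<comment> \<open>The factor \<open>p - 1\<close> in the exponent makes both sides
    \<open>(p - 1)\<close>-th powers, and \<open>p - 1 > 0\<close> allows taking the root.\<close>
  also have "p ^ (\<alpha> * (p - 1) * w) = (q ^ w) ^ (p - 1)"
    by (simp add: assms(4) mult_ac flip: power_mult)
  finally have "(q ^ N) ^ (p - 1) \<le> (card (zero_set N r f) * q ^ w) ^ (p - 1)"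
    by (simp add: cardG supp power_mult_distrib)
  then have "q ^ N \<le> card (zero_set N r f) * q ^ w"
    using p by (subst (asm) power_mono_iff) auto
  then have "real q ^ N \<le> real (card (zero_set N r f)) * real q ^ w"
    by (metis of_nat_le_iff of_nat_mult of_nat_power)
  then have "real q powi (int N - int w) \<le> real (card (zero_set N r f))"
    using q by (simp add: power_int_diff field_simps)
  then show ?thesis
    by (simp add: w_def)
qed

end
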